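(* Let $\mathfrak{O}\mathbb{M}$ be the frame of open sets of the Michael line $\mathbb{M}$. Then $\mathfrak{O}\mathbb{M}$ is perfectly regular but not perfectly normal.
   Context: The Michael line $\mathbb{M}$ is the space whose points are those of $\mathbb{R}$ and whose open sets are exactly the sets $U\cup K$ with $U$ open in $\mathbb{R}$ (usual topology) and $K\subseteq\mathbb{P}$, where $\mathbb{P}$ is the set of irrational numbers. An element $a$ of a frame $L$ is a cozero element if $a=h(\mathbb{R}\setminus\{0\})$ for some frame homomorphism $h:\mathfrak{O}\mathbb{R}\to L$ ($\mathfrak{O}\mathbb{R}$ being the frame of opens of the real line with its usual topology); $\mathrm{Coz}\,L$ is the set of cozero elements of $L$. A subset $A\subseteq L$ join-generates (meet-generates) $L$ if every element of $L$ is a join (meet), computed in $L$, of elements of $A$. A frame $L$ is perfectly regular if $\mathrm{Coz}\,L$ both join-generates and meet-generates $L$; it is perfectly normal if $\mathrm{Coz}\,L=L$. *)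

theory Defs
  imports "HOL-Analysis.Analysis" "HOL-Algebra.Complete_Lattice"
begin

section \<open>Frames\<close>

locale frame = complete_lattice L for L (structure) +
  assumes frame_distrib:
    "\<lbrakk>a \<in> carrier L; S \<subseteq> carrier L\<rbrakk> \<Longrightarrow> a \<sqinter> (\<Squnion>S) = \<Squnion>((\<lambda>s. a \<sqinter> s) ` S)"

text \<open>The empty join and the empty meet are included, so bottom and top are preserved.\<close>

definition frame_hom :: "('a, 'c) gorder_scheme \<Rightarrow> ('b, 'd) gorder_scheme \<Rightarrow> ('a \<Rightarrow> 'b) \<Rightarrow> bool"
  where "frame_hom L M h \<longleftrightarrow>
    h \<in> carrier L \<rightarrow> carrier M \<and>
    (\<forall>S. S \<subseteq> carrier L \<longrightarrow> h (\<Squnion>\<^bsub>L\<^esub>S) = \<Squnion>\<^bsub>M\<^esub>(h ` S)) \<and>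
    (\<forall>S. S \<subseteq> carrier L \<and> finite S \<longrightarrow> h (\<Sqinter>\<^bsub>L\<^esub>S) = \<Sqinter>\<^bsub>M\<^esub>(h ` S))"

definition opens_frame :: "'a topology \<Rightarrow> 'a set gorder"
  where "opens_frame X = \<lparr>carrier = {U. openin X U}, eq = (=), le = (\<subseteq>)\<rparr>"

definition Coz :: "('a, 'c) gorder_scheme \<Rightarrow> 'a set"
  where "Coz L = {h (UNIV - {0}) | h. frame_hom (opens_frame (euclidean :: real topology)) L h}"

definition join_generates :: "('a, 'c) gorder_scheme \<Rightarrow> 'a set \<Rightarrow> bool"
  where "join_generates L A \<longleftrightarrow>
    A \<subseteq> carrier L \<and> (\<forall>x \<in> carrier L. \<exists>S. S \<subseteq> A \<and> x = \<Squnion>\<^bsub>L\<^esub>S)"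

definition meet_generates :: "('a, 'c) gorder_scheme \<Rightarrow> 'a set \<Rightarrow> bool"
  where "meet_generates L A \<longleftrightarrow>
    A \<subseteq> carrier L \<and> (\<forall>x \<in> carrier L. \<exists>S. S \<subseteq> A \<and> x = \<Sqinter>\<^bsub>L\<^esub>S)"

definition perfectly_regular :: "('a, 'c) gorder_scheme \<Rightarrow> bool"
  where "perfectly_regular L \<longleftrightarrow>
    frame L \<and> join_generates L (Coz L) \<and> meet_generates L (Coz L)"

definition perfectly_normal :: "('a, 'c) gorder_scheme \<Rightarrow> bool"
  where "perfectly_normal L \<longleftrightarrow> frame L \<and> Coz L = carrier L"


section \<open>The Michael line\<close>

definition michael_line :: "real topology"
  where "michael_line = topology (\<lambda>S. \<exists>U K. open U \<and> K \<subseteq> - \<rat> \<and> S = U \<union> K)"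

text \<open>The family above is a topology, so \<open>topology\<close> does not lose information.\<close>

lemma openin_michael_line:
  "openin michael_line S \<longleftrightarrow> (\<exists>U K. open U \<and> K \<subseteq> - \<rat> \<and> S = U \<union> K)"
proof -
  have eq: "(\<exists>U K. open U \<and> K \<subseteq> - \<rat> \<and> S = U \<union> K) \<longleftrightarrow> S \<inter> \<rat> \<subseteq> interior S" for S :: "real set"
  proof
    assume "\<exists>U K. open U \<and> K \<subseteq> - \<rat> \<and> S = U \<union> K"
    then obtain U K where UK: "open U" "K \<subseteq> - \<rat>" "S = U \<union> K" by blast
    then have "U \<subseteq> interior S" by (intro interior_maximal) auto
    then show "S \<inter> \<rat> \<subseteq> interior S" using UK by blast
  next
    assume "S \<inter> \<rat> \<subseteq> interior S"
    then have "S = interior S \<union> (S - \<rat>)" using interior_subset by blast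
    then show "\<exists>U K. open U \<and> K \<subseteq> - \<rat> \<and> S = U \<union> K"
      by (intro exI[of _ "interior S"] exI[of _ "S - \<rat>"]) auto
  qed
  have "istopology (\<lambda>S :: real set. S \<inter> \<rat> \<subseteq> interior S)"
    unfolding istopology_def
  proof (intro conjI allI impI)
    fix S T :: "real set"
    assume "S \<inter> \<rat> \<subseteq> interior S" "T \<inter> \<rat> \<subseteq> interior T"
    then show "S \<inter> T \<inter> \<rat> \<subseteq> interior (S \<inter> T)" by auto
  next
    fix \<K> :: "real set set"
    assume K: "\<forall>S\<in>\<K>. S \<inter> \<rat> \<subseteq> interior S"
    have "interior S \<subseteq> interior (\<Union>\<K>)" if "S \<in> \<K>" for S
      using that by (intro interior_mono) auto
    then show "\<Union>\<K> \<inter> \<rat> \<subseteq> interior (\<Union>\<K>)" using K by blast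
  qed
  then show ?thesis
    unfolding michael_line_def eq by simp
qed

end

(*
  Every singleton complement is a cozero set of the Michael line, and every open set is the
  intersection of such complements, hence their meet; a Euclidean open set is the cozero set of
  the distance to its complement and an irrational point is clopen, so the cozero sets also form
  a base.  On the other hand, applying a frame homomorphism h to the sets |x| < 1/n shows that
  h(R - {0}) is the union of the closed complements of their images, so every cozero element of
  a frame of opens is an F-sigma set.  An F-sigma presentation of the irrationals in the Michael
  line would exhibit the rationals as a Euclidean G-delta set, contradicting Baire's theorem.
*)
theory Submission
  imports Defs
begin

section \<open>Joins and meets in the frame of opens of a space\<close>

lemma carrier_opens_frame [simp]: "carrier (opens_frame X) = {U. openin X U}"
  by (simp add: opens_frame_def)

lemma le_opens_frame [simp]: "(\<sqsubseteq>\<^bsub>opens_frame X\<^esub>) = (\<subseteq>)"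
  by (simp add: opens_frame_def)

lemma partial_order_opens_frame: "partial_order (opens_frame X)"
  by standard (auto simp: opens_frame_def)

lemma least_Upper_opens_frame:
  assumes "S \<subseteq> {U. openin X U}"
  shows "least (opens_frame X) (\<Union>S) (Upper (opens_frame X) S)"
  using assms by (auto simp: least_def Upper_def)

text \<open>An infinite intersection of open sets need not be open, so the meet is its interior. The
  factor \<open>topspace X\<close> makes the empty meet the top element, since
  \<open>\<Inter>{}\<close> is \<open>UNIV\<close>.\<close>

lemma greatest_Lower_opens_frame:
  assumes "S \<subseteq> {U. openin X U}"
  shows "greatest (opens_frame X) (X interior_of (topspace X \<inter> \<Inter>S)) (Lower (opens_frame X) S)"
proof -
  have "X interior_of (topspace X \<inter> \<Inter>S) \<subseteq> U" if "U \<in> S" for U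
    using interior_of_subset[of X "topspace X \<inter> \<Inter>S"] that by blast
  moreover have "V \<subseteq> X interior_of (topspace X \<inter> \<Inter>S)"
    if "openin X V" "\<And>U. U \<in> S \<Longrightarrow> V \<subseteq> U" for V
    using that by (intro interior_of_maximal) (auto dest: openin_subset)
  ultimately show ?thesis
    using assms unfolding greatest_def Lower_def by simp blast
qed

lemma complete_lattice_opens_frame: "complete_lattice (opens_frame X)"
proof (rule partial_order.complete_latticeI[OF partial_order_opens_frame])
  fix S assume "S \<subseteq> carrier (opens_frame X)"
  then have S: "S \<subseteq> {U. openin X U}" by simp
  show "\<exists>s. least (opens_frame X) s (Upper (opens_frame X) S)"
    using least_Upper_opens_frame[OF S] by blast
  show "\<exists>i. greatest (opens_frame X) i (Lower (opens_frame X) S)"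
    using greatest_Lower_opens_frame[OF S] by blast
qed

lemma sup_opens_frame:
  assumes "S \<subseteq> {U. openin X U}"
  shows "\<Squnion>\<^bsub>opens_frame X\<^esub>S = \<Union>S"
proof -
  note * = least_Upper_opens_frame[OF assms]
  show ?thesis
    unfolding Lattice.sup_def
    \<comment> \<open>The join is a \<open>SOME\<close>-choice among least upper bounds;
      antisymmetry leaves only one candidate.\<close>
    using partial_order.least_unique[OF partial_order_opens_frame _ *] * by (rule some_equality[rotated])
qed

lemma inf_opens_frame:
  assumes "S \<subseteq> {U. openin X U}"
  shows "\<Sqinter>\<^bsub>opens_frame X\<^esub>S = X interior_of (topspace X \<inter> \<Inter>S)"
proof -
  note * = greatest_Lower_opens_frame[OF assms]
  show ?thesis
    unfolding Lattice.inf_def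
    using partial_order.greatest_unique[OF partial_order_opens_frame _ *] * by (rule some_equality[rotated])
qed

lemma inf_opens_frame_openin:
  assumes "S \<subseteq> {U. openin X U}" "openin X (topspace X \<inter> \<Inter>S)"
  shows "\<Sqinter>\<^bsub>opens_frame X\<^esub>S = topspace X \<inter> \<Inter>S"
  using assms by (simp add: inf_opens_frame interior_of_openin)

lemma inf_opens_frame_finite:
  assumes "S \<subseteq> {U. openin X U}" "finite S"
  shows "\<Sqinter>\<^bsub>opens_frame X\<^esub>S = topspace X \<inter> \<Inter>S"
proof (rule inf_opens_frame_openin[OF assms(1)])
  show "openin X (topspace X \<inter> \<Inter>S)"
    using assms(2,1)
  proof (induction S rule: finite_induct)
    case (insert U S)
    then have "openin X (U \<inter> (topspace X \<inter> \<Inter>S))" by (intro openin_Int[of X U]) auto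
    moreover have "topspace X \<inter> \<Inter>(insert U S) = U \<inter> (topspace X \<inter> \<Inter>S)" by blast
    ultimately show ?case by (simp only:)
  qed simp
qed

lemma meet_opens_frame:
  assumes "openin X U" "openin X V"
  shows "U \<sqinter>\<^bsub>opens_frame X\<^esub> V = U \<inter> V"
  using assms by (auto simp: Lattice.meet_def inf_opens_frame_finite dest: openin_subset)

lemma frame_opens_frame: "frame (opens_frame X)"
proof (intro frame.intro frame_axioms.intro)
  show "complete_lattice (opens_frame X)" by (rule complete_lattice_opens_frame)
next
  fix U S assume "U \<in> carrier (opens_frame X)" "S \<subseteq> carrier (opens_frame X)"
  then have U: "openin X U" and S: "S \<subseteq> {V. openin X V}" by auto
  have "(\<lambda>V. U \<sqinter>\<^bsub>opens_frame X\<^esub> V) ` S = (\<lambda>V. U \<inter> V) ` S"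
    using U S by (intro image_cong refl meet_opens_frame) auto
  moreover have US: "(\<lambda>V. U \<inter> V) ` S \<subseteq> {V. openin X V}" using U S by auto
  moreover have "openin X (\<Union>S)" using S by auto
  ultimately show "U \<sqinter>\<^bsub>opens_frame X\<^esub> \<Squnion>\<^bsub>opens_frame X\<^esub>S
      = \<Squnion>\<^bsub>opens_frame X\<^esub>((\<lambda>V. U \<sqinter>\<^bsub>opens_frame X\<^esub> V) ` S)"
    using U by (simp only: meet_opens_frame sup_opens_frame[OF S] sup_opens_frame[OF US] Int_Union)
qed

section \<open>Frame homomorphisms and cozero elements\<close>

lemma frame_hom_preimage:
  assumes f: "continuous_map X Y f"
  shows "frame_hom (opens_frame Y) (opens_frame X) (\<lambda>U. {x \<in> topspace X. f x \<in> U})"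
    (is "frame_hom _ _ ?h")
proof -
  have h: "openin X (?h U)" if "openin Y U" for U
    using f that by (rule openin_continuous_map_preimage)
  show ?thesis
    unfolding frame_hom_def
  proof (intro conjI allI impI)
    show "?h \<in> carrier (opens_frame Y) \<rightarrow> carrier (opens_frame X)"
      using h by simp
  next
    fix S assume "S \<subseteq> carrier (opens_frame Y)"
    then have S: "S \<subseteq> {U. openin Y U}" by simp
    then have hS: "?h ` S \<subseteq> {U. openin X U}" using h by blast
    show "?h (\<Squnion>\<^bsub>opens_frame Y\<^esub>S) = \<Squnion>\<^bsub>opens_frame X\<^esub>(?h ` S)"
      unfolding sup_opens_frame[OF S] sup_opens_frame[OF hS] by blast
  next
    fix S assume "S \<subseteq> carrier (opens_frame Y) \<and> finite S"
    then have S: "S \<subseteq> {U. openin Y U}" and fin: "finite S" by auto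
    then have hS: "?h ` S \<subseteq> {U. openin X U}" using h by blast
    show "?h (\<Sqinter>\<^bsub>opens_frame Y\<^esub>S) = \<Sqinter>\<^bsub>opens_frame X\<^esub>(?h ` S)"
      unfolding inf_opens_frame_finite[OF S fin] inf_opens_frame_finite[OF hS finite_imageI[OF fin]]
      \<comment> \<open>As \<open>f\<close> maps into \<open>topspace Y\<close>, the factor
        \<open>topspace Y\<close> of the meet pulls back to all of
        \<open>topspace X\<close>.\<close>
      using continuous_map_image_subset_topspace[OF f] by auto
  qed
qed

lemma Coz_opens_frameI:
  assumes "continuous_map X euclideanreal f"
  shows "{x \<in> topspace X. f x \<noteq> 0} \<in> Coz (opens_frame X)"
  unfolding Coz_def using frame_hom_preimage[OF assms]
  by (intro CollectI exI[of _ "\<lambda>U. {x \<in> topspace X. f x \<in> U}"]) simp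

lemma Coz_opens_frame_subset: "Coz (opens_frame X) \<subseteq> {U. openin X U}"
proof -
  have "open (UNIV - {0 :: real})" by (simp add: open_delete)
  then show ?thesis by (auto simp: Coz_def frame_hom_def Pi_iff)
qed

text \<open>The argument uses only that \<open>h\<close> preserves covers and disjointness; no
  continuous function is recovered from \<open>h\<close>.\<close>

lemma fsigma_in_Coz_opens_frame:
  assumes "c \<in> Coz (opens_frame X)"
  shows "fsigma_in X c"
proof -
  obtain h where hom: "frame_hom (opens_frame (euclidean :: real topology)) (opens_frame X) h"
    and c: "c = h (UNIV - {0})"
    using assms by (auto simp: Coz_def)
  have opn: "openin X (h U)" if "open U" for U
    using hom that by (auto simp: frame_hom_def Pi_iff)
  have Sup: "h (\<Union>S) = (\<Union>U\<in>S. h U)" if "\<And>U. U \<in> S \<Longrightarrow> open U" for S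
  proof -
    have S: "S \<subseteq> {U. openin euclidean U}" using that by auto
    have hS: "h ` S \<subseteq> {U. openin X U}" using that opn by auto
    have "h (\<Squnion>\<^bsub>opens_frame euclidean\<^esub>S) = \<Squnion>\<^bsub>opens_frame X\<^esub>(h ` S)"
      using hom S by (simp add: frame_hom_def)
    then show ?thesis by (simp only: sup_opens_frame[OF S] sup_opens_frame[OF hS])
  qed
  have Inf: "h (\<Inter>S) = topspace X \<inter> (\<Inter>U\<in>S. h U)" if "\<And>U. U \<in> S \<Longrightarrow> open U" "finite S" for S
  proof -
    have S: "S \<subseteq> {U. openin euclidean U}" using that by auto
    have hS: "h ` S \<subseteq> {U. openin X U}" using that opn by auto
    have "h (\<Sqinter>\<^bsub>opens_frame euclidean\<^esub>S) = \<Sqinter>\<^bsub>opens_frame X\<^esub>(h ` S)"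
      using hom S \<open>finite S\<close> by (simp add: frame_hom_def)
    then show ?thesis
      using inf_opens_frame_finite[OF S] inf_opens_frame_finite[OF hS] \<open>finite S\<close> by simp
  qed
  \<comment> \<open>The empty join and the empty meet yield bottom and top.\<close>
  have h_empty: "h {} = {}" using Sup[of "{}"] by simp
  have h_UNIV: "h UNIV = topspace X" using Inf[of "{}"] by simp
  have h_Un: "h (U \<union> V) = h U \<union> h V" if "open U" "open V" for U V
    using Sup[of "{U, V}"] that by auto
  have h_Int: "h (U \<inter> V) = h U \<inter> h V" if "open U" "open V" for U V
    using Inf[of "{U, V}"] that opn[THEN openin_subset, of U] by auto
  \<comment> \<open>The sets \<open>A n\<close> exhaust the punctured line. Each \<open>B n\<close>
    is a neighbourhood of 0 disjoint from \<open>A n\<close>; \<open>Suc n\<close> keeps the radius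
    positive.\<close>
  define A where "A n = {x :: real. inverse (real (Suc n)) < \<bar>x\<bar>}" for n
  define B where "B n = {x :: real. \<bar>x\<bar> < inverse (real (Suc n))}" for n
  have open_A: "open (A n)" and open_B: "open (B n)" for n
    unfolding A_def B_def by (intro open_Collect_less continuous_intros)+
  have "UNIV - {0} = \<Union>(range A)"
  proof -
    have "\<exists>n. x \<in> A n" if "x \<noteq> 0" for x
      using reals_Archimedean[of "\<bar>x\<bar>"] that by (auto simp: A_def)
    moreover have "0 \<notin> A n" for n by (simp add: A_def)
    ultimately show ?thesis by blast
  qed
  then have c_Union: "c = (\<Union>n. h (A n))"
    using Sup[of "range A"] open_A by (auto simp: c)
  have "h (A n) \<subseteq> topspace X - h (B n)" for n
  proof -
    have "A n \<inter> B n = {}" by (auto simp: A_def B_def)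
    then show ?thesis
      using h_Int[OF open_A open_B, of n n] h_empty opn[OF open_A, THEN openin_subset, of n] by auto
  qed
  moreover have "topspace X - h (B n) \<subseteq> c" for n
  proof -
    have "(UNIV - {0}) \<union> B n = UNIV" by (auto simp: B_def)
    then show ?thesis
      using h_Un[of "UNIV - {0}" "B n"] open_B h_UNIV by (auto simp: c open_delete)
  qed
  \<comment> \<open>Each complement of \<open>h (B n)\<close> lies between \<open>h (A n)\<close>
    and \<open>c\<close>, and the \<open>h (A n)\<close> already have union
    \<open>c\<close>.\<close>
  ultimately have "c = (\<Union>n. topspace X - h (B n))"
    using c_Union by blast
  moreover have "closedin X (topspace X - h (B n))" for n
    using opn[OF open_B] by (rule closedin_diff[OF closedin_topspace])
  then have "fsigma_in X (\<Union>n. topspace X - h (B n))"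
    by (intro fsigma_in_Union) (auto intro: closed_imp_fsigma_in)
  ultimately show ?thesis by simp
qed

section \<open>Cozero sets of the Michael line\<close>

lemma openin_michael_line_interior:
  "openin michael_line S \<Longrightarrow> S \<inter> \<rat> \<subseteq> interior S"
  by (auto simp: openin_michael_line dest: interior_maximal[OF Un_upper1, THEN subsetD])

lemma open_imp_openin_michael_line: "open U \<Longrightarrow> openin michael_line U"
  unfolding openin_michael_line by blast

lemma topspace_michael_line [simp]: "topspace michael_line = UNIV"
  using open_imp_openin_michael_line[of UNIV] openin_subset by blast

text \<open>The Michael topology refines the Euclidean one, so enlarging the domain topology
  preserves continuity.\<close>

lemma continuous_map_michael_line:
  assumes "continuous_on UNIV f"
  shows "continuous_map michael_line euclidean f"
  using assms open_imp_openin_michael_line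
  by (auto simp: continuous_map_def continuous_on_open_vimage vimage_def)

lemma open_in_Coz_michael_line:
  assumes "open U"
  shows "U \<in> Coz (opens_frame michael_line)"
\<comment> \<open>\<open>infdist\<close> to the empty set is 0 by convention, so the whole line
  needs a nonzero constant instead.\<close>
proof (cases "U = UNIV")
  case True
  then show ?thesis
    using Coz_opens_frameI[of michael_line "\<lambda>_. 1"] by simp
next
  case False
  then have "U = {x \<in> topspace michael_line. infdist x (- U) \<noteq> 0}"
    using assms in_closed_iff_infdist_zero[of "- U"] by auto
  then show ?thesis
    using Coz_opens_frameI[OF continuous_map_michael_line, of "\<lambda>x. infdist x (- U)"]
    by (simp add: continuous_on_infdist)
qed

text \<open>The point is isolated and its complement is Euclidean open, so the singleton is clopen
  and its indicator is continuous.\<close>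

lemma irrational_singleton_in_Coz_michael_line:
  assumes "x \<notin> \<rat>"
  shows "{x} \<in> Coz (opens_frame michael_line)"
proof -
  have x: "openin michael_line {x}"
    using assms by (auto simp: openin_michael_line)
  have "openin michael_line (UNIV - {x})"
    by (intro open_imp_openin_michael_line) (simp add: open_delete)
  have "continuous_map michael_line euclideanreal (indicator {x})"
    unfolding continuous_map_def
  proof (intro conjI allI impI)
    fix V :: "real set"
    have "{y \<in> topspace michael_line. indicator {x} y \<in> V}
        = (if 1 \<in> V then {x} else {}) \<union> (if 0 \<in> V then UNIV - {x} else {})"
      by (auto simp: indicator_def)
    then show "openin michael_line {y \<in> topspace michael_line. indicator {x} y \<in> V}"
      using x \<open>openin michael_line (UNIV - {x})\<close> by (simp add: openin_Un)
  qed simp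
  moreover have "{y \<in> topspace michael_line. indicator {x} y \<noteq> (0 :: real)} = {x}"
    by (auto simp: indicator_def)
  ultimately show ?thesis
    using Coz_opens_frameI by metis
qed

lemma join_generates_Coz_michael_line:
  "join_generates (opens_frame michael_line) (Coz (opens_frame michael_line))"
  unfolding join_generates_def
proof (intro conjI ballI)
  show "Coz (opens_frame michael_line) \<subseteq> carrier (opens_frame michael_line)"
    using Coz_opens_frame_subset by simp
next
  fix W assume "W \<in> carrier (opens_frame michael_line)"
  then obtain U K where UK: "open U" "K \<subseteq> - \<rat>" "W = U \<union> K"
    by (auto simp: openin_michael_line)
  let ?S = "insert U ((\<lambda>x. {x}) ` K)"
  have S: "?S \<subseteq> Coz (opens_frame michael_line)"
    using UK open_in_Coz_michael_line irrational_singleton_in_Coz_michael_line by blast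
  then have "\<Squnion>\<^bsub>opens_frame michael_line\<^esub>?S = \<Union>?S"
    using Coz_opens_frame_subset by (intro sup_opens_frame) blast
  then show "\<exists>S \<subseteq> Coz (opens_frame michael_line). W = \<Squnion>\<^bsub>opens_frame michael_line\<^esub>S"
    using S UK by (intro exI[of _ ?S]) auto
qed

lemma meet_generates_Coz_michael_line:
  "meet_generates (opens_frame michael_line) (Coz (opens_frame michael_line))"
  unfolding meet_generates_def
proof (intro conjI ballI)
  show "Coz (opens_frame michael_line) \<subseteq> carrier (opens_frame michael_line)"
    using Coz_opens_frame_subset by simp
next
  fix W assume "W \<in> carrier (opens_frame michael_line)"
  then have W: "openin michael_line W" by simp
  let ?S = "(\<lambda>x. UNIV - {x}) ` (- W)"
  have S: "?S \<subseteq> Coz (opens_frame michael_line)"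
    by (auto intro!: open_in_Coz_michael_line open_delete)
  have Inter: "topspace michael_line \<inter> \<Inter>?S = W" by auto
  \<comment> \<open>The intersection is already open, so taking the interior does not shrink
    it.\<close>
  have "\<Sqinter>\<^bsub>opens_frame michael_line\<^esub>?S = W"
    using inf_opens_frame_openin[of ?S michael_line] S Coz_opens_frame_subset W
    unfolding Inter by blast
  then show "\<exists>S \<subseteq> Coz (opens_frame michael_line). W = \<Sqinter>\<^bsub>opens_frame michael_line\<^esub>S"
    using S by (intro exI[of _ ?S]) simp
qed

section \<open>The Baire category argument\<close>

lemma irrationals_not_fsigma_in_michael_line: "\<not> fsigma_in michael_line (- \<rat>)"
proof
  assume "fsigma_in michael_line (- \<rat>)"
  then obtain \<C> where \<C>: "countable \<C>" "\<And>C. C \<in> \<C> \<Longrightarrow> closedin michael_line C" "\<Union>\<C> = - \<rat>"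
    by (auto simp: fsigma_in_def union_of_def)
  \<comment> \<open>Baire's theorem concerns the Euclidean line, hence the Euclidean interiors. The
    first family excludes every irrational, the second every rational.\<close>
  let ?\<G> = "(\<lambda>C. interior (- C)) ` \<C> \<union> (\<lambda>q. - {q}) ` \<rat>"
  have "UNIV \<subseteq> closure (\<Inter>?\<G>)"
  proof (rule Baire)
    show "countable ?\<G>" using \<C>(1) by (simp add: countable_rat)
    fix T assume "T \<in> ?\<G>"
    then consider C where "C \<in> \<C>" "T = interior (- C)" | q where "T = - {q}" by blast
    then show "openin (top_of_set UNIV) T \<and> UNIV \<subseteq> closure T"
    proof cases
      case 1
      \<comment> \<open>\<open>C\<close> contains no rationals, so all of them lie in the
        Michael-open set \<open>- C\<close> and thus in its Euclidean interior, which is therefore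
        dense.\<close>
      have "openin michael_line (- C)"
        using \<C>(2)[OF 1(1)] by (simp add: closedin_def Compl_eq_Diff_UNIV)
      then have "\<rat> \<subseteq> T"
        using openin_michael_line_interior[of "- C"] 1 \<C>(3) by blast
      then have "closure \<rat> \<subseteq> closure T" by (rule closure_mono)
      then show ?thesis using 1(2) by (simp add: Rats_closure_real)
    next
      case 2
      then show ?thesis by (simp add: closure_complement open_Compl)
    qed
  qed simp
  moreover have "\<Inter>?\<G> = {}"
  proof -
    have False if "x \<in> \<Inter>?\<G>" for x
    proof (cases "x \<in> \<rat>")
      case True
      then show ?thesis using that by blast
    next
      case False
      then obtain C where "C \<in> \<C>" "x \<in> C" using \<C>(3) by blast
      then show ?thesis using that interior_subset[of "- C"] by blast
    qed
    then show ?thesis by blast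
  qed
  ultimately show False by simp
qed

theorem theorem2p6:
  shows "perfectly_regular (opens_frame michael_line) \<and> \<not> perfectly_normal (opens_frame michael_line)"
proof
  show "perfectly_regular (opens_frame michael_line)"
    unfolding perfectly_regular_def
    using frame_opens_frame join_generates_Coz_michael_line meet_generates_Coz_michael_line by blast
  have "openin michael_line (- \<rat>)"
    by (auto simp: openin_michael_line)
  then show "\<not> perfectly_normal (opens_frame michael_line)"
    using fsigma_in_Coz_opens_frame irrationals_not_fsigma_in_michael_line
    by (auto simp: perfectly_normal_def)
qed

end
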